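(* Let $\mathcal{V}=(\mathcal{G},\mathcal{L},P)$ be a densely valued $\ell$-group. Then there is a divisible $o$-group $\Gamma$ such that $\mathcal{V}$ embeds (as a valued $\ell$-group) into the standard structure $\operatorname{Stan}(\Gamma^{\operatorname{Spec}(\mathcal{L})})$.
   Context: All $\ell$-groups are abelian lattice-ordered groups. A divisible $o$-group (DOAG) is a nontrivial divisible totally ordered abelian group. For a set $X$ and $o$-group $\Gamma$, $\Gamma^X$ is the $\ell$-group of functions $X\to\Gamma$ with pointwise operations. A valued $\ell$-group is a triple $(\mathcal{G},\mathcal{L},P)$ with $\mathcal{G}$ an $\ell$-group, $\mathcal{L}$ a bounded distributive lattice ($\sqcap,\sqcup,\bot,\top,\sqsubseteq$), and $P:\mathcal{G}\to\mathcal{L}$ such that for all $a,b$: $P(a\wedge b)=P(a)\sqcap P(b)$, $P(a\vee b)=P(a)\sqcup P(b)$, $P(0)=\top$, $P(a)\sqcap P(b)\sqsubseteq P(a+b)$, and every element of $\mathcal{L}$ other than $\bot$ is of the form $P(a)$; it is densely valued if moreover $P(a)=\top$ implies $a\geq 0$. An embedding of valued $\ell$-groups $(\mathcal{G},\mathcal{L},P)\to(\mathcal{H},\mathcal{K},Q)$ is a pair $(I,J)$ with $I:\mathcal{G}\to\mathcal{H}$ an injective $\ell$-group homomorphism and $J:\mathcal{L}\to\mathcal{K}$ an injective bounded lattice homomorphism such that $Q\circ I=J\circ P$. The standard structure $\operatorname{Stan}(\Gamma^X)$ is the triple $(\Gamma^X,\mathcal{P}(X),f\mapsto\{f\geq0\})$,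 where $\mathcal{P}(X)$ is the power set lattice and $\{f\geq 0\}=\{x\in X: f(x)\geq 0\}$. $\operatorname{Spec}(\mathcal{L})$ is the set of prime filters of $\mathcal{L}$. *)

theory Defs
  imports "HOL-Algebra.Lattice" "HOL-Algebra.Product_Groups"
begin

text \<open>
  Ordered groups are written multiplicatively, as is usual in HOL-Algebra: \<open>\<otimes>\<close>, \<open>\<one>\<close> and
  \<open>inv\<close> stand for \<open>+\<close>, \<open>0\<close> and \<open>-\<close>.  The order is a field of the group record; to use the
  order and lattice theory of HOL-Algebra, \<open>order_of G\<close> repackages it as a \<open>gorder\<close>.
\<close>

record 'a ogroup = "'a monoid" +
  gle :: "'a \<Rightarrow> 'a \<Rightarrow> bool" (infixl \<open>\<preceq>\<index>\<close> 50)

definition order_of :: "('a, 'b) ogroup_scheme \<Rightarrow> 'a gorder" where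
  "order_of G = \<lparr>carrier = carrier G, eq = (=), le = gle G\<rparr>"

locale l_group = comm_group G for G :: "('a, 'b) ogroup_scheme" (structure) +
  assumes lattice_order: "lattice (order_of G)"
    and translation:
      "\<lbrakk>a \<in> carrier G; b \<in> carrier G; c \<in> carrier G; a \<preceq> b\<rbrakk> \<Longrightarrow> a \<otimes> c \<preceq> b \<otimes> c"

locale o_group = comm_group G for G :: "('a, 'b) ogroup_scheme" (structure) +
  assumes total_order: "total_order (order_of G)"
    and translation:
      "\<lbrakk>a \<in> carrier G; b \<in> carrier G; c \<in> carrier G; a \<preceq> b\<rbrakk> \<Longrightarrow> a \<otimes> c \<preceq> b \<otimes> c"

locale divisible_o_group = o_group G for G :: "('a, 'b) ogroup_scheme" (structure) +
  assumes nontrivial: "carrier G \<noteq> {\<one>}"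
    and divisible: "\<lbrakk>a \<in> carrier G; 0 < (n::nat)\<rbrakk> \<Longrightarrow> \<exists>b\<in>carrier G. b [^] n = a"

locale bounded_distrib_lattice = bounded_lattice L for L (structure) +
  assumes distrib:
    "\<lbrakk>u \<in> carrier L; v \<in> carrier L; w \<in> carrier L\<rbrakk>
      \<Longrightarrow> u \<sqinter> (v \<squnion> w) = (u \<sqinter> v) \<squnion> (u \<sqinter> w)"

record ('g, 'l) valued =
  vgroup :: "'g ogroup"
  vlattice :: "'l gorder"
  val :: "'g \<Rightarrow> 'l"

definition valued_l_group :: "('g, 'l) valued \<Rightarrow> bool" where
  "valued_l_group V \<longleftrightarrow>
    (let G = vgroup V; L = vlattice V; P = val V in
      l_group G \<and> bounded_distrib_lattice L \<and>
      P \<in> carrier G \<rightarrow> carrier L \<and>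
      (\<forall>a\<in>carrier G. \<forall>b\<in>carrier G. P (a \<sqinter>\<^bsub>order_of G\<^esub> b) = P a \<sqinter>\<^bsub>L\<^esub> P b) \<and>
      (\<forall>a\<in>carrier G. \<forall>b\<in>carrier G. P (a \<squnion>\<^bsub>order_of G\<^esub> b) = P a \<squnion>\<^bsub>L\<^esub> P b) \<and>
      P \<one>\<^bsub>G\<^esub> = \<top>\<^bsub>L\<^esub> \<and>
      (\<forall>a\<in>carrier G. \<forall>b\<in>carrier G. P a \<sqinter>\<^bsub>L\<^esub> P b \<sqsubseteq>\<^bsub>L\<^esub> P (a \<otimes>\<^bsub>G\<^esub> b)) \<and>
      (\<forall>u\<in>carrier L. u \<noteq> \<bottom>\<^bsub>L\<^esub> \<longrightarrow> (\<exists>a\<in>carrier G. u = P a)))"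

definition densely_valued :: "('g, 'l) valued \<Rightarrow> bool" where
  "densely_valued V \<longleftrightarrow> valued_l_group V \<and>
    (\<forall>a\<in>carrier (vgroup V). val V a = \<top>\<^bsub>vlattice V\<^esub> \<longrightarrow> \<one>\<^bsub>vgroup V\<^esub> \<preceq>\<^bsub>vgroup V\<^esub> a)"

definition l_group_hom :: "'g ogroup \<Rightarrow> 'h ogroup \<Rightarrow> ('g \<Rightarrow> 'h) \<Rightarrow> bool" where
  "l_group_hom G H I \<longleftrightarrow> I \<in> hom G H \<and>
    meet_pres (order_of G) (order_of H) I \<and> join_pres (order_of G) (order_of H) I"

definition bounded_lattice_hom :: "'l gorder \<Rightarrow> 'k gorder \<Rightarrow> ('l \<Rightarrow> 'k) \<Rightarrow> bool" where
  "bounded_lattice_hom L K J \<longleftrightarrow> J \<in> carrier L \<rightarrow> carrier K \<and>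
    meet_pres L K J \<and> join_pres L K J \<and> J \<bottom>\<^bsub>L\<^esub> = \<bottom>\<^bsub>K\<^esub> \<and> J \<top>\<^bsub>L\<^esub> = \<top>\<^bsub>K\<^esub>"

definition valued_embedding ::
    "('g, 'l) valued \<Rightarrow> ('h, 'k) valued \<Rightarrow> ('g \<Rightarrow> 'h) \<Rightarrow> ('l \<Rightarrow> 'k) \<Rightarrow> bool" where
  "valued_embedding V W I J \<longleftrightarrow>
    l_group_hom (vgroup V) (vgroup W) I \<and> inj_on I (carrier (vgroup V)) \<and>
    bounded_lattice_hom (vlattice V) (vlattice W) J \<and> inj_on J (carrier (vlattice V)) \<and>
    (\<forall>a\<in>carrier (vgroup V). val W (I a) = J (val V a))"

definition embeds :: "('g, 'l) valued \<Rightarrow> ('h, 'k) valued \<Rightarrow> bool" where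
  "embeds V W \<longleftrightarrow> (\<exists>I J. valued_embedding V W I J)"

text \<open>Functions \<open>X \<rightarrow> \<Gamma>\<close> are represented as extensional functions (\<open>undefined\<close> off \<open>X\<close>).\<close>

definition fun_group :: "'x set \<Rightarrow> 'a ogroup \<Rightarrow> ('x \<Rightarrow> 'a) ogroup" where
  "fun_group X \<Gamma> =
    \<lparr>carrier = carrier (product_group X (\<lambda>_. \<Gamma>)),
     monoid.mult = (\<otimes>\<^bsub>product_group X (\<lambda>_. \<Gamma>)\<^esub>),
     one = \<one>\<^bsub>product_group X (\<lambda>_. \<Gamma>)\<^esub>,
     gle = (\<lambda>f g. \<forall>x\<in>X. f x \<preceq>\<^bsub>\<Gamma>\<^esub> g x)\<rparr>"

definition powerset_lattice :: "'x set \<Rightarrow> 'x set gorder" where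
  "powerset_lattice X = \<lparr>carrier = Pow X, eq = (=), le = (\<subseteq>)\<rparr>"

definition Stan :: "'x set \<Rightarrow> 'a ogroup \<Rightarrow> ('x \<Rightarrow> 'a, 'x set) valued" where
  "Stan X \<Gamma> =
    \<lparr>vgroup = fun_group X \<Gamma>,
     vlattice = powerset_lattice X,
     val = (\<lambda>f. {x \<in> X. \<one>\<^bsub>\<Gamma>\<^esub> \<preceq>\<^bsub>\<Gamma>\<^esub> f x})\<rparr>"

definition lattice_filter :: "'l gorder \<Rightarrow> 'l set \<Rightarrow> bool" where
  "lattice_filter L F \<longleftrightarrow> F \<subseteq> carrier L \<and> F \<noteq> {} \<and>
    (\<forall>u\<in>F. \<forall>v\<in>F. u \<sqinter>\<^bsub>L\<^esub> v \<in> F) \<and>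
    (\<forall>u\<in>F. \<forall>v\<in>carrier L. u \<sqsubseteq>\<^bsub>L\<^esub> v \<longrightarrow> v \<in> F)"

definition prime_filter :: "'l gorder \<Rightarrow> 'l set \<Rightarrow> bool" where
  "prime_filter L F \<longleftrightarrow> lattice_filter L F \<and> F \<noteq> carrier L \<and>
    (\<forall>u\<in>carrier L. \<forall>v\<in>carrier L. u \<squnion>\<^bsub>L\<^esub> v \<in> F \<longrightarrow> u \<in> F \<or> v \<in> F)"

definition Spec :: "'l gorder \<Rightarrow> 'l set set" where
  "Spec L = {F. prime_filter L F}"

text \<open>
  HOL cannot quantify existentially over types, so the elements of \<open>\<Gamma>\<close> must be drawn from a
  fixed type depending on the types \<open>'g\<close> of \<open>\<G>\<close> and \<open>'l\<close> of \<open>\<L>\<close>.  The type below is large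
  enough to be no restriction: it holds the equivalence classes of formal fractions \<open>(f, k)/n\<close>
  with \<open>f\<close> a family of group elements indexed by \<open>Spec \<L>\<close> and \<open>k\<close> an integer, hence a
  divisible hull of any quotient of a subgroup of \<open>\<G>\<^bsup>Spec \<L>\<^esup> \<times> \<int>\<close>.  The carrier of \<open>\<Gamma>\<close>
  may be any subset of it.
\<close>

type_synonym ('g, 'l) fractions = "(('l set \<Rightarrow> 'g) \<times> int \<times> nat) set"

end

(*
  A prime filter p of L turns G into a totally preordered group: the a with P a in p form a
  submonoid containing a or its inverse for every a, because P (a join its inverse) = top.
  The corresponding quotient map is an l-homomorphism onto an o-group in which a is nonnegative
  exactly when P a lies in p.  All these o-groups sit inside one: order G^(Spec L) x Z
  lexicographically along a well-order of Spec L (the factor Z only makes the group nontrivial)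
  and pass to the divisible hull.  The family of these homomorphisms is injective by the prime
  filter theorem together with density.  Totally preordered groups are handled through their
  cones, so that the only quotient formed is that of the fractions.
*)

theory Submission
  imports Defs
begin

section \<open>Divisible hulls of totally preordered abelian groups\<close>

text \<open>Call an element null if both it and its inverse lie in the cone. The obstacle is that
  different prime filters have different null elements, hence different quotients, while a single
  \<Gamma> must serve every coordinate. A product contains each quotient as one coordinate, but its
  pointwise order is not total; deciding by the first non-null coordinate is. The integers come last
  in this comparison, so that the identity family paired with -1 is strictly negative even if G is
  trivial or Spec L is empty. Of the maps \<phi> into \<Gamma> only two things are recorded: they
  are homomorphisms, and \<phi> a is nonnegative exactly when P a lies in p. Monotonicity and
  compatibility with meets and joins are derived from these, so the lattice argument never looks
  inside \<Gamma>.\<close>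

locale total_cone = comm_group G for G (structure) +
  fixes C
  assumes cone_subset: "C \<subseteq> carrier G"
    and cone_mult: "\<lbrakk>x \<in> C; y \<in> C\<rbrakk> \<Longrightarrow> x \<otimes> y \<in> C"
    and cone_total: "x \<in> carrier G \<Longrightarrow> x \<in> C \<or> inv x \<in> C"
begin

lemma one_in_cone: "\<one> \<in> C"
  using cone_total[of \<one>] by simp

definition cone_le (infixl \<open>\<unlhd>\<close> 50) where
  "x \<unlhd> y \<longleftrightarrow> y \<otimes> inv x \<in> C"

lemma cone_le_refl: "x \<in> carrier G \<Longrightarrow> x \<unlhd> x"
  by (simp add: cone_le_def one_in_cone)

lemma cone_le_trans:
  assumes "x \<unlhd> y" "y \<unlhd> z" "x \<in> carrier G" "y \<in> carrier G" "z \<in> carrier G"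
  shows "x \<unlhd> z"
proof -
  have "(z \<otimes> inv y) \<otimes> (y \<otimes> inv x) = z \<otimes> inv x"
    using assms by (metis inv_closed inv_solve_right m_assoc m_closed)
  then show ?thesis
    using assms cone_mult unfolding cone_le_def by metis
qed

lemma cone_le_linear:
  assumes "x \<in> carrier G" "y \<in> carrier G"
  shows "x \<unlhd> y \<or> y \<unlhd> x"
proof -
  have "inv (y \<otimes> inv x) = x \<otimes> inv y"
    using assms by (simp add: inv_mult_group)
  then show ?thesis
    using assms cone_total[of "y \<otimes> inv x"] by (auto simp: cone_le_def)
qed

lemma one_cone_le_iff: "x \<in> carrier G \<Longrightarrow> \<one> \<unlhd> x \<longleftrightarrow> x \<in> C"
  by (simp add: cone_le_def)

lemma cone_le_mult_right:
  assumes "x \<in> carrier G" "y \<in> carrier G" "z \<in> carrier G"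
  shows "x \<otimes> z \<unlhd> y \<otimes> z \<longleftrightarrow> x \<unlhd> y"
proof -
  have "(y \<otimes> z) \<otimes> inv (x \<otimes> z) = y \<otimes> inv x"
    using assms by (simp add: inv_mult m_ac r_inv_ex inv_solve_right')
  then show ?thesis
    by (simp add: cone_le_def)
qed

lemma cone_le_mult:
  assumes "x \<unlhd> y" "u \<unlhd> v" "x \<in> carrier G" "y \<in> carrier G" "u \<in> carrier G" "v \<in> carrier G"
  shows "x \<otimes> u \<unlhd> y \<otimes> v"
proof (rule cone_le_trans)
  show "x \<otimes> u \<unlhd> y \<otimes> u"
    using assms by (simp add: cone_le_mult_right)
  show "y \<otimes> u \<unlhd> y \<otimes> v"
    using assms cone_le_mult_right[of u v y] by (simp add: m_comm)
qed (use assms in auto)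

lemma cone_le_pow:
  assumes "x \<unlhd> y" "x \<in> carrier G" "y \<in> carrier G"
  shows "x [^] (n::nat) \<unlhd> y [^] n"
  by (induction n) (use assms in \<open>auto simp: cone_le_refl cone_le_mult\<close>)

text \<open>If the conclusion failed, totality would give \<open>y \<unlhd> x\<close>. Replacing all
  but one factor of \<open>x [^] n\<close> by \<open>y\<close> then yields
  \<open>x \<otimes> y [^] m \<unlhd> y \<otimes> y [^] m\<close>, where n = m + 1, and cancelling
  the common power is a contradiction.\<close>

lemma cone_le_pow_cancel:
  assumes "x [^] n \<unlhd> y [^] n" "0 < (n::nat)" "x \<in> carrier G" "y \<in> carrier G"
  shows "x \<unlhd> y"
proof (rule ccontr)
  assume less: "\<not> x \<unlhd> y"
  then have le: "y \<unlhd> x"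
    using assms cone_le_linear by blast
  obtain m where n: "n = Suc m"
    using assms(2) gr0_implies_Suc by blast
  have "x \<otimes> y [^] m \<unlhd> x \<otimes> x [^] m"
    using assms le cone_le_mult cone_le_pow cone_le_refl by simp
  also have "x \<otimes> x [^] m \<unlhd> y \<otimes> y [^] m"
    using assms n by (simp add: m_comm)
  finally (cone_le_trans) have "x \<otimes> y [^] m \<unlhd> y \<otimes> y [^] m"
    using assms by simp
  then show False
    using assms less by (simp add: cone_le_mult_right)
qed

text \<open>In fractions: h/n \<le> k/m \<le> j/l. Raising the first inequality to the power l and
  the second to the power n gives both the middle term \<open>k [^] (n * l)\<close>; the surplus
  exponent m is cancelled at the end.\<close>

lemma fraction_le_trans:
  fixes n m l :: nat
  assumes "h [^] m \<unlhd> k [^] n" "k [^] l \<unlhd> j [^] m"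
    and G: "h \<in> carrier G" "k \<in> carrier G" "j \<in> carrier G" and pos: "0 < n" "0 < m" "0 < l"
  shows "h [^] l \<unlhd> j [^] n"
proof -
  have "(h [^] m) [^] l \<unlhd> (k [^] n) [^] l" "(k [^] l) [^] n \<unlhd> (j [^] m) [^] n"
    using assms by (simp_all add: cone_le_pow)
  then have "(h [^] l) [^] m \<unlhd> (k [^] n) [^] l" "(k [^] n) [^] l \<unlhd> (j [^] n) [^] m"
    using G by (simp_all add: nat_pow_pow mult.commute)
  then have "(h [^] l) [^] m \<unlhd> (j [^] n) [^] m"
    by (rule cone_le_trans) (use G in auto)
  then show ?thesis
    by (rule cone_le_pow_cancel) (use G pos in auto)
qed

text \<open>Adding k/m to h/n \<le> h'/n', with cross-multiplied denominators: the hypothesis is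
  raised to the power m * m and both sides are multiplied by \<open>k [^] (n * n' * m)\<close>.
  Applied in both directions it makes addition well defined; applied once it makes it
  monotone.\<close>

lemma fraction_add_mono:
  assumes "h [^] n' \<unlhd> h' [^] n"
    and "h \<in> carrier G" "h' \<in> carrier G" "k \<in> carrier G"
  shows "(h [^] m \<otimes> k [^] n) [^] (n' * m) \<unlhd> (h' [^] m \<otimes> k [^] n') [^] (n * (m::nat))"
proof -
  have "(h [^] n') [^] (m * m) \<unlhd> (h' [^] n) [^] (m * m)"
    using assms cone_le_pow by simp
  then have "(h [^] n') [^] (m * m) \<otimes> k [^] (n * n' * m) \<unlhd> (h' [^] n) [^] (m * m) \<otimes> k [^] (n * n' * m)"
    using assms by (simp add: cone_le_mult_right)
  then show ?thesis
    using assms by (simp add: nat_pow_distrib nat_pow_pow ac_simps)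
qed

end

text \<open>
  \<open>q h n\<close> stands for the fraction \<open>h/n\<close>.  Keeping \<open>q\<close> abstract leaves the type of the
  fractions open.
\<close>

locale cone_fractions = total_cone +
  fixes q :: "'a \<Rightarrow> nat \<Rightarrow> 't"
  assumes q_eq_iff: "\<lbrakk>h \<in> carrier G; k \<in> carrier G; 0 < n; 0 < m\<rbrakk>
    \<Longrightarrow> q h n = q k m \<longleftrightarrow> h [^] m \<unlhd> k [^] n \<and> k [^] n \<unlhd> h [^] m"
    and proper: "C \<noteq> carrier G"
begin

text \<open>Since \<open>q\<close> is abstract, no representative can be read off an element of
  \<open>'t\<close>. Product and order therefore range over all representatives; that the choice is
  immaterial is shown in \<open>frac_mult\<close> and \<open>gle_q_iff\<close>.\<close>

definition frac_group :: "'t ogroup" where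
  "frac_group =
    \<lparr>carrier = {q h n | h n. h \<in> carrier G \<and> 0 < n},
     monoid.mult = (\<lambda>s t. SOME u. \<exists>h\<in>carrier G. \<exists>n>0. \<exists>k\<in>carrier G. \<exists>m>0.
       s = q h n \<and> t = q k m \<and> u = q (h [^] m \<otimes> k [^] n) (n * m)),
     one = q \<one> 1,
     gle = (\<lambda>s t. \<exists>h\<in>carrier G. \<exists>n>0. \<exists>k\<in>carrier G. \<exists>m>0.
       s = q h n \<and> t = q k m \<and> h [^] m \<unlhd> k [^] n)\<rparr>"

lemma frac_carrier: "carrier frac_group = {q h n | h n. h \<in> carrier G \<and> 0 < n}"
  by (simp add: frac_group_def)

lemma frac_one: "\<one>\<^bsub>frac_group\<^esub> = q \<one> 1"
  by (simp add: frac_group_def)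

lemma q_closed: "\<lbrakk>h \<in> carrier G; 0 < n\<rbrakk> \<Longrightarrow> q h n \<in> carrier frac_group"
  by (auto simp: frac_carrier)

lemma frac_cases:
  assumes "s \<in> carrier frac_group"
  obtains h n where "h \<in> carrier G" "0 < n" "s = q h n"
  using assms by (auto simp: frac_carrier)

text \<open>Sufficient only: fractions also coincide when the two cross powers differ by a null
  element.\<close>

lemma q_eqI: "\<lbrakk>h [^] m = k [^] n; h \<in> carrier G; k \<in> carrier G; 0 < n; 0 < m\<rbrakk> \<Longrightarrow> q h n = q k m"
  by (simp add: q_eq_iff cone_le_refl)

lemma gle_q_iff:
  assumes "h \<in> carrier G" "k \<in> carrier G" "0 < n" "0 < m"
  shows "gle frac_group (q h n) (q k m) \<longleftrightarrow> h [^] m \<unlhd> k [^] n"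
proof
  assume "gle frac_group (q h n) (q k m)"
  then obtain h' n' k' m' where *: "h' \<in> carrier G" "0 < n'" "k' \<in> carrier G" "0 < m'"
    "q h n = q h' n'" "q k m = q k' m'" "h' [^] m' \<unlhd> k' [^] n'"
    by (auto simp: frac_group_def)
  \<comment> \<open>The chain is h/n \<le> h'/n' \<le> k'/m' \<le> k/m; only one half of each
    equality of fractions is needed.\<close>
  have "h [^] n' \<unlhd> h' [^] n" "k' [^] m \<unlhd> k [^] m'"
    using * assms by (simp_all add: q_eq_iff)
  with * assms show "h [^] m \<unlhd> k [^] n"
    by (meson fraction_le_trans)
next
  assume "h [^] m \<unlhd> k [^] n"
  with assms show "gle frac_group (q h n) (q k m)"
    unfolding frac_group_def ogroup.simps by blast
qed

lemma fraction_add_cong: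
  assumes "q h n = q h' n'"
    and "h \<in> carrier G" "h' \<in> carrier G" "k \<in> carrier G" "0 < n" "0 < n'" "0 < m"
  shows "q (h [^] m \<otimes> k [^] n) (n * m) = q (h' [^] m \<otimes> k [^] n') (n' * m)"
  using assms by (simp add: q_eq_iff fraction_add_mono)

text \<open>Representatives are exchanged one at a time. \<open>fraction_add_cong\<close> replaces
  only the left summand, so the summands are swapped before and after the second exchange.\<close>

lemma frac_mult:
  assumes "h \<in> carrier G" "k \<in> carrier G" "0 < n" "0 < m"
  shows "q h n \<otimes>\<^bsub>frac_group\<^esub> q k m = q (h [^] m \<otimes> k [^] n) (n * m)"
proof -
  have "q (h' [^] m' \<otimes> k' [^] n') (n' * m') = q (h [^] m \<otimes> k [^] n) (n * m)"
    if "h' \<in> carrier G" "0 < n'" "k' \<in> carrier G" "0 < m'" "q h n = q h' n'" "q k m = q k' m'"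
    for h' n' k' m'
  proof -
    have "q (h' [^] m' \<otimes> k' [^] n') (n' * m') = q (h [^] m' \<otimes> k' [^] n) (n * m')"
      using that assms by (intro fraction_add_cong) auto
    also have "\<dots> = q (k' [^] n \<otimes> h [^] m') (m' * n)"
      using that assms by (simp add: m_comm mult.commute)
    also have "\<dots> = q (k [^] n \<otimes> h [^] m) (m * n)"
      using that assms by (intro fraction_add_cong) auto
    also have "\<dots> = q (h [^] m \<otimes> k [^] n) (n * m)"
      using that assms by (simp add: m_comm mult.commute)
    finally show ?thesis .
  qed
  then show ?thesis
    unfolding frac_group_def monoid.simps
    by (intro some_equality) (use assms in blast)+
qed

lemma frac_comm_group: "comm_group frac_group"
proof (rule comm_groupI)
  fix s t assume "s \<in> carrier frac_group" "t \<in> carrier frac_group"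
  then obtain h n k m where *: "h \<in> carrier G" "0 < n" "s = q h n" "k \<in> carrier G" "0 < m" "t = q k m"
    by (metis frac_cases)
  then show "s \<otimes>\<^bsub>frac_group\<^esub> t \<in> carrier frac_group" "s \<otimes>\<^bsub>frac_group\<^esub> t = t \<otimes>\<^bsub>frac_group\<^esub> s"
    by (simp_all add: frac_mult q_closed m_comm mult.commute)
next
  fix s t u assume "s \<in> carrier frac_group" "t \<in> carrier frac_group" "u \<in> carrier frac_group"
  then obtain h n k m j l where "h \<in> carrier G" "0 < n" "s = q h n"
    "k \<in> carrier G" "0 < m" "t = q k m" "j \<in> carrier G" "0 < l" "u = q j l"
    by (metis frac_cases)
  then show "s \<otimes>\<^bsub>frac_group\<^esub> t \<otimes>\<^bsub>frac_group\<^esub> u = s \<otimes>\<^bsub>frac_group\<^esub> (t \<otimes>\<^bsub>frac_group\<^esub> u)"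
    by (simp add: frac_mult nat_pow_distrib nat_pow_pow m_assoc ac_simps)
next
  fix s assume "s \<in> carrier frac_group"
  then obtain h n where *: "h \<in> carrier G" "0 < n" "s = q h n"
    by (metis frac_cases)
  then show "\<one>\<^bsub>frac_group\<^esub> \<otimes>\<^bsub>frac_group\<^esub> s = s"
    by (simp add: frac_mult frac_one)
  have "q (inv h) n \<otimes>\<^bsub>frac_group\<^esub> s = q \<one> (n * n)"
    using * by (simp add: frac_mult flip: nat_pow_distrib)
  also have "\<dots> = \<one>\<^bsub>frac_group\<^esub>"
    unfolding frac_one using * by (intro q_eqI) auto
  finally show "\<exists>t\<in>carrier frac_group. t \<otimes>\<^bsub>frac_group\<^esub> s = \<one>\<^bsub>frac_group\<^esub>"
    using * by (meson inv_closed q_closed)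
qed (simp add: frac_one q_closed)

lemma frac_total_order: "total_order (order_of frac_group)"
proof -
  have trans: "gle frac_group s u" if le: "gle frac_group s t" "gle frac_group t u"
    and carr: "s \<in> carrier frac_group" "t \<in> carrier frac_group" "u \<in> carrier frac_group" for s t u
  proof -
    obtain h n k m j l where *: "h \<in> carrier G" "0 < n" "s = q h n"
      "k \<in> carrier G" "0 < m" "t = q k m" "j \<in> carrier G" "0 < l" "u = q j l"
      using carr by (metis frac_cases)
    with le have "h [^] m \<unlhd> k [^] n" "k [^] l \<unlhd> j [^] m"
      by (simp_all add: gle_q_iff)
    then have "h [^] l \<unlhd> j [^] n"
      by (rule fraction_le_trans) (use * in auto)
    then show ?thesis
      using * by (simp add: gle_q_iff)
  qed
  have antisym: "s = t" if "gle frac_group s t" "gle frac_group t s"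
    "s \<in> carrier frac_group" "t \<in> carrier frac_group" for s t
    using that by (elim frac_cases) (simp add: gle_q_iff q_eq_iff)
  have total: "gle frac_group s t \<or> gle frac_group t s"
    if "s \<in> carrier frac_group" "t \<in> carrier frac_group" for s t
    using that by (elim frac_cases) (simp add: gle_q_iff cone_le_linear)
  show ?thesis
    by unfold_locales (auto simp: order_of_def intro: trans antisym dest: total)
qed

lemma frac_pow:
  assumes "h \<in> carrier G" "0 < n"
  shows "q h n [^]\<^bsub>frac_group\<^esub> (l::nat) = q (h [^] l) n"
proof (induction l)
  case 0
  show ?case
    using assms by (auto simp: frac_one intro!: q_eqI)
next
  case (Suc l)
  have "q h n [^]\<^bsub>frac_group\<^esub> Suc l = q (h [^] l) n \<otimes>\<^bsub>frac_group\<^esub> q h n"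
    by (simp add: Suc)
  also have "\<dots> = q (h [^] Suc l) n"
    using assms
    by (auto simp: frac_mult nat_pow_distrib nat_pow_pow ac_simps intro!: q_eqI)
  finally show ?case .
qed

lemma divisible_o_group_frac: "divisible_o_group frac_group"
proof -
  interpret F: comm_group frac_group
    by (rule frac_comm_group)
  show ?thesis
  proof (intro divisible_o_group.intro o_group.intro o_group_axioms.intro
      divisible_o_group_axioms.intro frac_comm_group)
    show "total_order (order_of frac_group)"
      by (rule frac_total_order)
    show "gle frac_group (s \<otimes>\<^bsub>frac_group\<^esub> u) (t \<otimes>\<^bsub>frac_group\<^esub> u)"
      if "s \<in> carrier frac_group" "t \<in> carrier frac_group" "u \<in> carrier frac_group"
        "gle frac_group s t" for s t u
      using that by (elim frac_cases) (simp add: frac_mult gle_q_iff fraction_add_mono)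
    \<comment> \<open>An element outside the cone is strictly negative, so its fraction differs from
      the identity.\<close>
    obtain x where "x \<in> carrier G" "x \<notin> C"
      using proper cone_subset by blast
    then have "q x 1 \<noteq> q \<one> 1"
      using one_cone_le_iff by (simp add: q_eq_iff)
    then show "carrier frac_group \<noteq> {\<one>\<^bsub>frac_group\<^esub>}"
      using \<open>x \<in> carrier G\<close> frac_one q_closed[of x 1] by auto
    show "\<exists>t\<in>carrier frac_group. t [^]\<^bsub>frac_group\<^esub> l = s"
      if "s \<in> carrier frac_group" "0 < l" for s and l :: nat
    proof -
      obtain h n where *: "h \<in> carrier G" "0 < n" "s = q h n"
        using \<open>s \<in> carrier frac_group\<close> by (metis frac_cases)
      \<comment> \<open>The root of order l of h/n is h/(n l); the surplus l cancels against the
        numerator \<open>h [^] l\<close>.\<close>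
      have "q h (n * l) [^]\<^bsub>frac_group\<^esub> l = s"
        using * that by (simp add: frac_pow) (intro q_eqI, auto simp: nat_pow_pow mult.commute)
      then show ?thesis
        using * that by (intro bexI[of _ "q h (n * l)"]) (simp_all add: q_closed)
    qed
  qed
qed

lemma q_hom: "(\<lambda>h. q h 1) \<in> hom G frac_group"
  by (rule homI) (simp_all add: q_closed frac_mult)

lemma one_gle_q_iff: "h \<in> carrier G \<Longrightarrow> gle frac_group \<one>\<^bsub>frac_group\<^esub> (q h 1) \<longleftrightarrow> h \<in> C"
  by (simp add: frac_one gle_q_iff one_cone_le_iff)

end

section \<open>Lexicographic cones\<close>

text \<open>\<open>D\<close> is the lexicographic cone in which the first component dominates: the
  integer is consulted only when that component is null.\<close>

lemma total_cone_lex_int: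
  fixes G (structure)
  assumes "total_cone G C"
  defines "D \<equiv> {(a, k). a \<in> C \<and> (inv\<^bsub>G\<^esub> a \<in> C \<longrightarrow> (0::int) \<le> k)}"
  shows "total_cone (G \<times>\<times> integer_group) D"
proof -
  interpret total_cone G C by (rule assms(1))
  interpret Z: comm_group integer_group by (rule abelian_integer_group)
  interpret GZ: group "G \<times>\<times> integer_group"
    by (intro DirProd_group) auto
  interpret GZ: comm_group "G \<times>\<times> integer_group"
    by (rule GZ.group_comm_groupI) (auto simp: m_comm)
  \<comment> \<open>A product of two elements of the cone is null only if both factors are. Hence
    the integer of a product matters only where both integers are already known to be
    nonnegative.\<close>
  have inv_left: "inv x \<in> C" if "x \<in> C" "y \<in> C" "inv (x \<otimes> y) \<in> C" for x y
  proof -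
    have "y \<otimes> inv (x \<otimes> y) = inv x"
      using that cone_subset by (simp add: inv_mult_group subset_iff flip: m_assoc)
    then show ?thesis
      using cone_mult that by metis
  qed
  show ?thesis
  proof unfold_locales
    show "D \<subseteq> carrier (G \<times>\<times> integer_group)"
      using cone_subset by (auto simp: D_def)
    show "x \<otimes>\<^bsub>G \<times>\<times> integer_group\<^esub> y \<in> D" if "x \<in> D" "y \<in> D" for x y
    proof -
      obtain a k b l where xy: "x = (a, k)" "y = (b, l)"
        by (cases x, cases y)
      with that have ab: "a \<in> C" "b \<in> C"
        and kl: "inv a \<in> C \<Longrightarrow> 0 \<le> k" "inv b \<in> C \<Longrightarrow> 0 \<le> l"
        by (auto simp: D_def)
      have "a \<otimes> b = b \<otimes> a"
        using ab cone_subset by (auto intro: m_comm)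
      then have "0 \<le> k + l" if "inv (a \<otimes> b) \<in> C"
        using that kl inv_left[OF ab] inv_left[OF ab(2,1)] by simp
      then show ?thesis
        using ab by (simp add: xy D_def cone_mult)
    qed
    show "x \<in> D \<or> inv\<^bsub>G \<times>\<times> integer_group\<^esub> x \<in> D" if "x \<in> carrier (G \<times>\<times> integer_group)" for x
      using that cone_total by (cases x) (auto simp: D_def)
  qed
qed

text \<open>
  If every cone \<open>C p\<close> is total, this says that the first non-null coordinate of \<open>f\<close>,
  if any, is positive; phrased without mentioning a first coordinate it needs no existence argument.
\<close>

definition lex_cone ::
    "('i \<times> 'i) set \<Rightarrow> 'i set \<Rightarrow> ('a, 'b) monoid_scheme \<Rightarrow> ('i \<Rightarrow> 'a set) \<Rightarrow> ('i \<Rightarrow> 'a) set" where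
  "lex_cone r X G C = {f \<in> X \<rightarrow>\<^sub>E carrier G. \<forall>p\<in>X.
     (\<forall>q\<in>X. (q, p) \<in> r \<longrightarrow> f q \<in> C q \<and> inv\<^bsub>G\<^esub> f q \<in> C q) \<longrightarrow> f p \<in> C p}"

text \<open>Closure under products rests on the fact that if \<open>f \<otimes> g\<close> is null
  before p, then so are f and g separately. For totality, a coordinate at which the inverse of f
  fails to be in the cone is one at which f is strictly positive, with nothing but null coordinates
  before it.\<close>

lemma total_cone_lex:
  fixes G (structure)
  assumes G: "comm_group G" and cone: "\<And>p. p \<in> X \<Longrightarrow> total_cone G (C p)"
    and r: "wf r" "trans r" "total_on X r"
  shows "total_cone (product_group X (\<lambda>_. G)) (lex_cone r X G C)"
proof -
  interpret comm_group G by fact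
  interpret P: group "product_group X (\<lambda>_. G)"
    by (simp add: group_axioms)
  interpret P: comm_group "product_group X (\<lambda>_. G)"
    by (rule P.group_comm_groupI) (auto intro!: restrict_ext m_comm)
  have mult: "(\<lambda>p\<in>X. f p \<otimes> g p) \<in> lex_cone r X G C"
    if f: "f \<in> lex_cone r X G C" and g: "g \<in> lex_cone r X G C" for f g
  proof -
    have fc: "f p \<in> carrier G" and gc: "g p \<in> carrier G" if "p \<in> X" for p
      using f g that by (auto simp: lex_cone_def)
    have "f p \<otimes> g p \<in> C p" if p: "p \<in> X"
      and null: "\<And>q. \<lbrakk>q \<in> X; (q, p) \<in> r\<rbrakk> \<Longrightarrow> f q \<otimes> g q \<in> C q \<and> inv (f q \<otimes> g q) \<in> C q" for p
    proof -
      \<comment> \<open>By well-founded induction f and g are null before q, so membership in the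
        lexicographic cone puts f q and g q in the cone at q. Their product is null, hence both
        are.\<close>
      have "f q \<in> C q \<and> inv f q \<in> C q \<and> g q \<in> C q \<and> inv g q \<in> C q" if "q \<in> X" "(q, p) \<in> r" for q
        using \<open>wf r\<close> that
      proof (induction q rule: wf_induct_rule)
        case (less q)
        interpret C: total_cone G "C q"
          using cone less.prems by blast
        have "(q', p) \<in> r" if "(q', q) \<in> r" for q'
          using that less.prems \<open>trans r\<close> by (meson transD)
        then have fq: "f q \<in> C q" and gq: "g q \<in> C q"
          using f g less by (auto simp: lex_cone_def)
        have "inv f q = g q \<otimes> inv (f q \<otimes> g q)"
          using fc gc less.prems by (simp add: inv_mult_group flip: m_assoc)
        moreover have "inv g q = f q \<otimes> inv (f q \<otimes> g q)"
          using fc gc less.prems by (simp add: inv_mult flip: m_assoc)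
        ultimately show ?case
          using fq gq null[OF less.prems] C.cone_mult by metis
      qed
      then have "f p \<in> C p" "g p \<in> C p"
        using f g p by (auto simp: lex_cone_def)
      then show ?thesis
        using cone[OF p] by (simp add: total_cone.cone_mult)
    qed
    then show ?thesis
      using fc gc by (auto simp: lex_cone_def)
  qed
  have total: "f \<in> lex_cone r X G C \<or> (\<lambda>p\<in>X. inv f p) \<in> lex_cone r X G C"
    if f: "f \<in> X \<rightarrow>\<^sub>E carrier G" for f
  proof (rule disjCI)
    assume "(\<lambda>p\<in>X. inv f p) \<notin> lex_cone r X G C"
    then obtain p where p: "p \<in> X" "inv f p \<notin> C p"
      and null: "\<And>q. \<lbrakk>q \<in> X; (q, p) \<in> r\<rbrakk> \<Longrightarrow> f q \<in> C q"
      using f by (fastforce simp: lex_cone_def PiE_iff)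
    have "f s \<in> C s" if s: "s \<in> X"
      and "\<forall>q\<in>X. (q, s) \<in> r \<longrightarrow> f q \<in> C q \<and> inv f q \<in> C q" for s
    proof (cases "s = p")
      case True
      have "f p \<in> carrier G"
        using f p by auto
      with True show ?thesis
        using p cone[OF p(1)] by (metis total_cone.cone_total)
    next
      case False
      then show ?thesis
        \<comment> \<open>If s precedes p, then f is null at s. If p precedes s, the premise for s
          would put the inverse of f p in the cone, against the choice of p.\<close>
        using that p null \<open>total_on X r\<close> unfolding total_on_def by meson
    qed
    then show "f \<in> lex_cone r X G C"
      using f by (auto simp: lex_cone_def)
  qed
  show ?thesis
  proof unfold_locales
    show "lex_cone r X G C \<subseteq> carrier (product_group X (\<lambda>_. G))"
      by (auto simp: lex_cone_def)
  qed (use mult total in \<open>auto simp: group_axioms\<close>)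
qed


lemma lex_cone_single_iff:
  assumes "comm_group G" and cone: "\<And>p. p \<in> X \<Longrightarrow> total_cone G (C p)"
    and "wf r" and p: "p \<in> X" and a: "a \<in> carrier G"
  shows "(\<lambda>s\<in>X. if s = p then a else \<one>\<^bsub>G\<^esub>) \<in> lex_cone r X G C \<longleftrightarrow> a \<in> C p"
proof -
  interpret comm_group G by fact
  have one: "\<one>\<^bsub>G\<^esub> \<in> C s" if "s \<in> X" for s
    using cone[OF that] by (rule total_cone.one_in_cone)
  \<comment> \<open>With a loop at p the condition at p would presuppose its own conclusion and hold
    for every \<open>a\<close>.\<close>
  have "(p, p) \<notin> r"
    using \<open>wf r\<close> by simp
  then show ?thesis
    using p a one by (auto simp: lex_cone_def)
qed

text \<open>One group serves all p at once because the p-th coordinate inclusion of G into the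
  lexicographic product reflects exactly the cone \<open>C p\<close>: every other coordinate is the
  identity and cannot decide the sign.\<close>

lemma exists_divisible_o_group_separating_cones:
  fixes G :: "('a, 'b) monoid_scheme" and X :: "'i set"
  assumes G: "comm_group G" and cone: "\<And>p. p \<in> X \<Longrightarrow> total_cone G (C p)"
  shows "\<exists>\<Gamma> :: (('i \<Rightarrow> 'a) \<times> int \<times> nat) set ogroup. \<exists>\<phi>. divisible_o_group \<Gamma> \<and>
    (\<forall>p\<in>X. \<phi> p \<in> hom G \<Gamma> \<and> (\<forall>a\<in>carrier G. gle \<Gamma> \<one>\<^bsub>\<Gamma>\<^esub> (\<phi> p a) \<longleftrightarrow> a \<in> C p))"
proof -
  interpret G: comm_group G by fact
  obtain w :: "'i rel" where "Well_order w" "Field w = UNIV"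
    using well_ordering[where 'a = 'i] by auto
  then have w: "Linear_order w" "wf (w - Id)"
    unfolding well_order_on_def by simp_all
  \<comment> \<open>The strict part of a well-order of the whole index type; in particular it is
    total on X.\<close>
  define r where "r = w - Id"
  have r: "wf r" "trans r" "total_on X r"
    using w \<open>Field w = UNIV\<close>
    by (auto simp: r_def linear_order_on_def partial_order_on_def preorder_on_def total_on_def
        intro: trans_diff_Id)
  define H where "H = product_group X (\<lambda>_. G) \<times>\<times> integer_group"
  define D where "D = {(a, k). a \<in> lex_cone r X G C \<and>
    (inv\<^bsub>product_group X (\<lambda>_. G)\<^esub> a \<in> lex_cone r X G C \<longrightarrow> (0::int) \<le> k)}"
  have lex: "total_cone (product_group X (\<lambda>_. G)) (lex_cone r X G C)"
    using G cone r by (rule total_cone_lex)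
  interpret lex: total_cone "product_group X (\<lambda>_. G)" "lex_cone r X G C"
    by (rule lex)
  interpret H: total_cone H D
    unfolding H_def D_def using lex by (rule total_cone_lex_int)
  define equiv where "equiv h n k m \<longleftrightarrow>
    H.cone_le (h [^]\<^bsub>H\<^esub> m) (k [^]\<^bsub>H\<^esub> n) \<and> H.cone_le (k [^]\<^bsub>H\<^esub> n) (h [^]\<^bsub>H\<^esub> m)"
    for h k and n m :: nat
  \<comment> \<open>The fraction h/n is its class of representatives. The pair (a, k) from H is
    flattened with the denominator m into a triple, as the type of \<Gamma> demands.\<close>
  define q where "q h n = {(a, k, m). (a, k) \<in> carrier H \<and> 0 < m \<and> equiv h n (a, k) m}" for h n
  interpret F: cone_fractions H D q
  proof
    fix h k and n m :: nat
    assume *: "h \<in> carrier H" "k \<in> carrier H" "0 < n" "0 < m"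
    have "equiv h n k m" if "q h n = q k m"
    proof -
      have "(fst k, snd k, m) \<in> q k m"
        using * by (simp add: q_def equiv_def H.cone_le_refl)
      then show ?thesis
        unfolding that[symmetric] by (simp add: q_def)
    qed
    moreover have "equiv h n k m \<Longrightarrow> equiv h n j l \<longleftrightarrow> equiv k m j l"
      if "j \<in> carrier H" "0 < l" for j l
      using * that unfolding equiv_def by (meson H.fraction_le_trans)
    then have "q h n = q k m" if "equiv h n k m"
      using that by (auto simp: q_def)
    ultimately show "q h n = q k m \<longleftrightarrow> H.cone_le (h [^]\<^bsub>H\<^esub> m) (k [^]\<^bsub>H\<^esub> n) \<and>
        H.cone_le (k [^]\<^bsub>H\<^esub> n) (h [^]\<^bsub>H\<^esub> m)"
      unfolding equiv_def by blast
  next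
    \<comment> \<open>The identity family is null, so the integer decides, and -1 is
      negative.\<close>
    have "(\<one>\<^bsub>product_group X (\<lambda>_. G)\<^esub>, - 1) \<in> carrier H - D"
      using lex.one_closed lex.inv_one lex.one_in_cone by (simp add: H_def D_def)
    then show "D \<noteq> carrier H"
      by blast
  qed
  define single where "single p a = ((\<lambda>s\<in>X. if s = p then a else \<one>\<^bsub>G\<^esub>), 0::int)" for p a
  have hom: "(\<lambda>h. q h 1) \<circ> single p \<in> hom G F.frac_group" if "p \<in> X" for p
  proof (rule hom_compose[OF _ F.q_hom])
    show "single p \<in> hom G H"
      using that by (auto simp: single_def H_def intro!: homI restrict_ext)
  qed
  have sign: "gle F.frac_group \<one>\<^bsub>F.frac_group\<^esub> (q (single p a) 1) \<longleftrightarrow> a \<in> C p"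
    if "p \<in> X" "a \<in> carrier G" for p a
  proof -
    have "single p a \<in> carrier H"
      using that by (auto simp: single_def H_def)
    then have "gle F.frac_group \<one>\<^bsub>F.frac_group\<^esub> (q (single p a) 1) \<longleftrightarrow> single p a \<in> D"
      by (rule F.one_gle_q_iff)
    also have "\<dots> \<longleftrightarrow> a \<in> C p"
      unfolding single_def D_def using lex_cone_single_iff[OF G cone r(1) that] by simp
    finally show ?thesis .
  qed
  show ?thesis
    using F.divisible_o_group_frac hom sign
    by (intro exI[of _ F.frac_group] exI[of _ "\<lambda>p a. q (single p a) 1"]) (simp add: comp_def)
qed

section \<open>Lattice-ordered groups\<close>

text \<open>Meets are defined as chosen greatest lower bounds. This form allows a concrete candidate
  to be identified with the chosen one; its dual follows.\<close>

lemma (in lattice) meet_eqI: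
  assumes "m \<in> carrier L" "m \<sqsubseteq> x" "m \<sqsubseteq> y" "x \<in> carrier L" "y \<in> carrier L"
    and "\<And>z. \<lbrakk>z \<in> carrier L; z \<sqsubseteq> x; z \<sqsubseteq> y\<rbrakk> \<Longrightarrow> z \<sqsubseteq> m"
  shows "x \<sqinter> y = m"
  using assms by (intro le_antisym meet_le) (simp_all add: meet_left meet_right)

lemma (in lattice) join_eqI:
  assumes "m \<in> carrier L" "x \<sqsubseteq> m" "y \<sqsubseteq> m" "x \<in> carrier L" "y \<in> carrier L"
    and "\<And>z. \<lbrakk>z \<in> carrier L; x \<sqsubseteq> z; y \<sqsubseteq> z\<rbrakk> \<Longrightarrow> m \<sqsubseteq> z"
  shows "x \<squnion> y = m"
  using assms by (intro le_antisym join_le) (simp_all add: join_left join_right)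

lemma order_of_simps [simp]:
  "carrier (order_of G) = carrier G"
  "le (order_of G) = gle G"
  "eq (order_of G) = (=)"
  by (simp_all add: order_of_def)

sublocale l_group \<subseteq> L: lattice "order_of G"
  rewrites "carrier (order_of G) = carrier G"
    and "le (order_of G) = gle G"
    and "eq (order_of G) = (=)"
  by (simp_all add: lattice_order)

sublocale o_group \<subseteq> l_group
proof (intro l_group.intro l_group_axioms.intro comm_group_axioms)
  interpret total_order "order_of G" by (rule total_order)
  show "lattice (order_of G)"
    by (rule weak.lattice_axioms)
qed (rule translation)

context l_group
begin

abbreviation gmeet (infixl \<open>\<and>\<^sub>G\<close> 70) where "a \<and>\<^sub>G b \<equiv> a \<sqinter>\<^bsub>order_of G\<^esub> b"
abbreviation gjoin (infixl \<open>\<or>\<^sub>G\<close> 65) where "a \<or>\<^sub>G b \<equiv> a \<squnion>\<^bsub>order_of G\<^esub> b"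

lemma translation_iff:
  assumes "a \<in> carrier G" "b \<in> carrier G" "c \<in> carrier G"
  shows "a \<otimes> c \<preceq> b \<otimes> c \<longleftrightarrow> a \<preceq> b"
proof
  assume "a \<otimes> c \<preceq> b \<otimes> c"
  then have "a \<otimes> c \<otimes> inv c \<preceq> b \<otimes> c \<otimes> inv c"
    using assms by (intro translation[of "a \<otimes> c"]) auto
  then show "a \<preceq> b"
    using assms by (simp add: m_assoc)
qed (use assms translation in auto)

lemma one_le_div_iff:
  assumes "a \<in> carrier G" "b \<in> carrier G"
  shows "\<one> \<preceq> b \<otimes> inv a \<longleftrightarrow> a \<preceq> b"
  using translation_iff[of \<one> "b \<otimes> inv a" a] assms by (simp add: m_assoc)

lemma div_le_iff:
  assumes "a \<in> carrier G" "b \<in> carrier G" "c \<in> carrier G"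
  shows "a \<otimes> inv c \<preceq> b \<longleftrightarrow> a \<preceq> b \<otimes> c" "b \<preceq> a \<otimes> inv c \<longleftrightarrow> b \<otimes> c \<preceq> a"
  using translation_iff[of "a \<otimes> inv c" b c] translation_iff[of b "a \<otimes> inv c" c] assms
  by (simp_all add: m_assoc)

text \<open>Translation by c is an order automorphism with inverse translation by
  \<open>inv c\<close>, so it preserves greatest lower bounds.\<close>

lemma meet_mult:
  assumes "a \<in> carrier G" "b \<in> carrier G" "c \<in> carrier G"
  shows "(a \<and>\<^sub>G b) \<otimes> c = (a \<otimes> c) \<and>\<^sub>G (b \<otimes> c)"
proof (rule sym, rule L.meet_eqI)
  fix z assume z: "z \<in> carrier G" "z \<preceq> a \<otimes> c" "z \<preceq> b \<otimes> c"
  then have "z \<otimes> inv c \<preceq> a \<and>\<^sub>G b"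
    using assms by (intro L.meet_le) (auto simp: div_le_iff)
  then show "z \<preceq> (a \<and>\<^sub>G b) \<otimes> c"
    using assms z by (simp add: div_le_iff)
qed (use assms L.meet_left L.meet_right in \<open>auto simp: translation_iff\<close>)

lemma join_mult:
  assumes "a \<in> carrier G" "b \<in> carrier G" "c \<in> carrier G"
  shows "(a \<or>\<^sub>G b) \<otimes> c = (a \<otimes> c) \<or>\<^sub>G (b \<otimes> c)"
proof (rule sym, rule L.join_eqI)
  fix z assume z: "z \<in> carrier G" "a \<otimes> c \<preceq> z" "b \<otimes> c \<preceq> z"
  then have "a \<or>\<^sub>G b \<preceq> z \<otimes> inv c"
    using assms by (intro L.join_le) (auto simp: div_le_iff)
  then show "(a \<or>\<^sub>G b) \<otimes> c \<preceq> z"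
    using assms z by (simp add: div_le_iff)
qed (use assms L.join_left L.join_right in \<open>auto simp: translation_iff\<close>)

text \<open>Additively, y = a \<or> -a satisfies y + y \<ge> a + (-a) = 0. It remains to halve this:
  for z = y \<and> 0, distributing translation over the meet turns z \<le> y + y into z \<le> z + y
  and then into z \<le> z + z, so 0 \<le> z \<le> y.\<close>

lemma one_le_join_inv:
  assumes a: "a \<in> carrier G"
  shows "\<one> \<preceq> a \<or>\<^sub>G inv a"
proof -
  define y where "y = a \<or>\<^sub>G inv a"
  define z where "z = y \<and>\<^sub>G \<one>"
  have y: "y \<in> carrier G" "a \<preceq> y" "inv a \<preceq> y"
    using a L.join_left L.join_right by (auto simp: y_def)
  then have z: "z \<in> carrier G" "z \<preceq> y" "z \<preceq> \<one>"
    using L.meet_left L.meet_right by (auto simp: z_def)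
  have "\<one> \<preceq> y \<otimes> inv a"
    using a y by (simp add: one_le_div_iff)
  also have "y \<otimes> inv a \<preceq> y \<otimes> y"
    using a y translation[of "inv a" y y] by (simp add: m_comm)
  finally (L.le_trans) have "\<one> \<preceq> y \<otimes> y"
    using a y by simp
  then have "z \<preceq> y \<otimes> y"
    using z y L.le_trans by blast
  then have "z \<preceq> z \<otimes> y"
    using z y by (simp add: z_def meet_mult L.meet_le)
  then have "\<one> \<otimes> z \<preceq> z \<otimes> z"
    using z y L.meet_le[of z "y \<otimes> z" z] by (simp add: z_def meet_mult m_comm)
  then have "\<one> \<preceq> z"
    using z translation_iff by blast
  then show ?thesis
    using z y L.le_trans unfolding y_def by blast
qed

end

section \<open>Prime filters\<close>

text \<open>Zorn's lemma gives a filter maximal among those containing u and omitting v. If it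
  contained a join but neither part, enlarging it by either part would bring in v; distributivity
  merges the two witnesses and puts v in the filter itself.\<close>

lemma exists_prime_filter:
  fixes L :: "'l gorder" (structure)
  assumes "bounded_distrib_lattice L"
    and u: "u \<in> carrier L" and v: "v \<in> carrier L" and "\<not> u \<sqsubseteq> v"
  shows "\<exists>p\<in>Spec L. u \<in> p \<and> v \<notin> p"
proof -
  interpret bounded_distrib_lattice L by fact
  define \<A> where "\<A> = {F. lattice_filter L F \<and> u \<in> F \<and> v \<notin> F}"
  have "{w \<in> carrier L. u \<sqsubseteq> w} \<in> \<A>"
    using assms unfolding \<A>_def lattice_filter_def by (auto intro: meet_le le_trans)
  moreover have "\<Union>\<C> \<in> \<A>" if "\<C> \<noteq> {}" "subset.chain \<A> \<C>" for \<C>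
  proof -
    have sub: "F \<subseteq> carrier L" "u \<in> F" "v \<notin> F"
      "x \<in> F \<Longrightarrow> y \<in> F \<Longrightarrow> x \<sqinter> y \<in> F" "x \<in> F \<Longrightarrow> y \<in> carrier L \<Longrightarrow> x \<sqsubseteq> y \<Longrightarrow> y \<in> F"
      if "F \<in> \<C>" for F x y
      using that \<open>subset.chain \<A> \<C>\<close> unfolding subset_chain_def \<A>_def lattice_filter_def by blast+
    have "x \<sqinter> y \<in> \<Union>\<C>" if xy: "x \<in> \<Union>\<C>" "y \<in> \<Union>\<C>" for x y
    proof -
      obtain F F' where *: "F \<in> \<C>" "F' \<in> \<C>" "x \<in> F" "y \<in> F'"
        using xy by blast
      then have "F \<subseteq> F' \<or> F' \<subseteq> F"
        using \<open>subset.chain \<A> \<C>\<close> unfolding subset_chain_def by blast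
      then show ?thesis
        using * sub(4) by blast
    qed
    moreover have "u \<in> \<Union>\<C>" "v \<notin> \<Union>\<C>" "\<Union>\<C> \<subseteq> carrier L"
      using \<open>\<C> \<noteq> {}\<close> sub(1-3) by auto
    moreover have "y \<in> \<Union>\<C>" if "x \<in> \<Union>\<C>" "y \<in> carrier L" "x \<sqsubseteq> y" for x y
      using that sub(5) by blast
    ultimately show ?thesis
      unfolding \<A>_def lattice_filter_def mem_Collect_eq by (intro conjI ballI impI) blast+
  qed
  ultimately obtain M where "M \<in> \<A>" and max: "\<And>F. F \<in> \<A> \<Longrightarrow> M \<subseteq> F \<Longrightarrow> F = M"
    using subset_Zorn_nonempty[of \<A>] by blast
  then have M: "lattice_filter L M" "u \<in> M" "v \<notin> M"
    by (auto simp: \<A>_def)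
  then have sub: "M \<subseteq> carrier L"
    and meet: "\<And>x y. x \<in> M \<Longrightarrow> y \<in> M \<Longrightarrow> x \<sqinter> y \<in> M"
    and up: "\<And>x y. x \<in> M \<Longrightarrow> y \<in> carrier L \<Longrightarrow> x \<sqsubseteq> y \<Longrightarrow> y \<in> M"
    by (auto simp: lattice_filter_def)
  have carr: "m \<in> carrier L" if "m \<in> M" for m
    using that sub by blast
  have extend: "\<exists>m\<in>M. m \<sqinter> x \<sqsubseteq> v" if x: "x \<in> carrier L" "x \<notin> M" for x
  proof -
    \<comment> \<open>The filter generated by M and x. It properly contains M, so by maximality it
      is excluded from \<open>\<A>\<close>, and the only condition it can violate is the omission of
      v.\<close>
    define F where "F = {w \<in> carrier L. \<exists>m\<in>M. m \<sqinter> x \<sqsubseteq> w}"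
    have "M \<subseteq> F"
      using x carr meet_left unfolding F_def by blast
    moreover have "x \<in> F"
      using x M(2) carr meet_right unfolding F_def by blast
    ultimately have "F \<notin> \<A>"
      using max x by blast
    moreover have "w \<sqinter> w' \<in> F" if "w \<in> F" "w' \<in> F" for w w'
    proof -
      obtain m m' where m: "m \<in> M" "m' \<in> M" "m \<sqinter> x \<sqsubseteq> w" "m' \<sqinter> x \<sqsubseteq> w'"
        using \<open>w \<in> F\<close> \<open>w' \<in> F\<close> by (auto simp: F_def)
      have w: "w \<in> carrier L" "w' \<in> carrier L"
        using \<open>w \<in> F\<close> \<open>w' \<in> F\<close> by (auto simp: F_def)
      have "m \<sqinter> m' \<sqinter> x \<sqsubseteq> m \<sqinter> x" "m \<sqinter> m' \<sqinter> x \<sqsubseteq> m' \<sqinter> x"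
        using m carr x by (meson le_trans meet_closed meet_le meet_left meet_right)+
      then have "m \<sqinter> m' \<sqinter> x \<sqsubseteq> w \<sqinter> w'"
        using m carr x w by (meson le_trans meet_closed meet_le)
      then show ?thesis
        using m meet w by (auto simp: F_def)
    qed
    moreover have "w' \<in> F" if "w \<in> F" "w' \<in> carrier L" "w \<sqsubseteq> w'" for w w'
    proof -
      obtain m where m: "m \<in> M" "m \<sqinter> x \<sqsubseteq> w" and w: "w \<in> carrier L"
        using \<open>w \<in> F\<close> by (auto simp: F_def)
      have "m \<sqinter> x \<sqsubseteq> w'"
        by (rule le_trans[OF m(2) \<open>w \<sqsubseteq> w'\<close>]) (use m w x that(2) carr in auto)
      then show ?thesis
        using m that(2) by (auto simp: F_def)
    qed
    moreover have "F \<subseteq> carrier L" "u \<in> F"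
      using \<open>M \<subseteq> F\<close> M(2) by (auto simp: F_def)
    ultimately have "v \<in> F"
      unfolding \<A>_def lattice_filter_def mem_Collect_eq by (metis empty_iff)
    then show ?thesis
      by (simp add: F_def)
  qed
  have "x \<in> M \<or> y \<in> M" if xy: "x \<in> carrier L" "y \<in> carrier L" "x \<squnion> y \<in> M" for x y
  proof (rule ccontr)
    assume "\<not> (x \<in> M \<or> y \<in> M)"
    then obtain m m' where m: "m \<in> M" "m' \<in> M" "m \<sqinter> x \<sqsubseteq> v" "m' \<sqinter> y \<sqsubseteq> v"
      using xy extend by meson
    \<comment> \<open>A common witness for x and y, needed before distributivity can be
      applied.\<close>
    define n where "n = m \<sqinter> m'"
    have n: "n \<in> M" "n \<in> carrier L" "n \<sqsubseteq> m" "n \<sqsubseteq> m'"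
      using m meet carr by (auto simp: n_def intro: meet_left meet_right)
    have "n \<sqinter> x \<sqsubseteq> m \<sqinter> x" "n \<sqinter> y \<sqsubseteq> m' \<sqinter> y"
      using m n carr xy by (meson le_trans meet_closed meet_le meet_left meet_right)+
    then have "n \<sqinter> x \<sqsubseteq> v" "n \<sqinter> y \<sqsubseteq> v"
      using m n carr xy v by (meson le_trans meet_closed)+
    then have "n \<sqinter> (x \<squnion> y) \<sqsubseteq> v"
      using n xy v by (simp add: distrib join_le)
    moreover have "n \<sqinter> (x \<squnion> y) \<in> M"
      using n xy meet by blast
    ultimately show False
      using up v M by blast
  qed
  moreover have "M \<noteq> carrier L"
    using v M by blast
  ultimately show ?thesis
    using M unfolding Spec_def prime_filter_def by (intro bexI[of _ M]) simp_all
qed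

section \<open>Power set lattices and the Stone map\<close>

lemma carrier_powerset_lattice: "carrier (powerset_lattice X) = Pow X"
  by (simp add: powerset_lattice_def)

lemma powerset_lattice_bounded: "bounded_lattice (powerset_lattice X)"
proof
  show "\<exists>s. least (powerset_lattice X) s (Upper (powerset_lattice X) {x, y})"
    if "x \<in> carrier (powerset_lattice X)" "y \<in> carrier (powerset_lattice X)" for x y
    using that by (intro exI[of _ "x \<union> y"]) (auto simp: powerset_lattice_def least_def Upper_def)
  show "\<exists>s. greatest (powerset_lattice X) s (Lower (powerset_lattice X) {x, y})"
    if "x \<in> carrier (powerset_lattice X)" "y \<in> carrier (powerset_lattice X)" for x y
    using that by (intro exI[of _ "x \<inter> y"]) (auto simp: powerset_lattice_def greatest_def Lower_def)
  show "\<exists>s. least (powerset_lattice X) s (carrier (powerset_lattice X))"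
    by (intro exI[of _ "{}"]) (auto simp: powerset_lattice_def least_def)
  show "\<exists>s. greatest (powerset_lattice X) s (carrier (powerset_lattice X))"
    by (intro exI[of _ X]) (auto simp: powerset_lattice_def greatest_def)
qed (auto simp: powerset_lattice_def)

lemma powerset_lattice_ops:
  shows "u \<subseteq> X \<Longrightarrow> v \<subseteq> X \<Longrightarrow> u \<sqinter>\<^bsub>powerset_lattice X\<^esub> v = u \<inter> v"
    and "u \<subseteq> X \<Longrightarrow> v \<subseteq> X \<Longrightarrow> u \<squnion>\<^bsub>powerset_lattice X\<^esub> v = u \<union> v"
    and "\<bottom>\<^bsub>powerset_lattice X\<^esub> = {}"
    and "\<top>\<^bsub>powerset_lattice X\<^esub> = X"
proof -
  interpret bounded_lattice "powerset_lattice X"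
    by (rule powerset_lattice_bounded)
  show "u \<subseteq> X \<Longrightarrow> v \<subseteq> X \<Longrightarrow> u \<sqinter>\<^bsub>powerset_lattice X\<^esub> v = u \<inter> v"
    by (intro meet_eqI) (auto simp: powerset_lattice_def)
  show "u \<subseteq> X \<Longrightarrow> v \<subseteq> X \<Longrightarrow> u \<squnion>\<^bsub>powerset_lattice X\<^esub> v = u \<union> v"
    by (intro join_eqI) (auto simp: powerset_lattice_def)
  show "\<bottom>\<^bsub>powerset_lattice X\<^esub> = {}"
    by (intro bottom_eq[symmetric]) (auto simp: powerset_lattice_def)
  show "\<top>\<^bsub>powerset_lattice X\<^esub> = X"
    by (intro top_eq[symmetric]) (auto simp: powerset_lattice_def)
qed

lemma
  fixes L :: "'l gorder" (structure)
  assumes "bounded_distrib_lattice L" and p: "p \<in> Spec L"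
  shows Spec_top: "\<top> \<in> p"
    and Spec_bottom: "\<bottom> \<notin> p"
    and Spec_up: "\<lbrakk>u \<in> p; u \<sqsubseteq> v; v \<in> carrier L\<rbrakk> \<Longrightarrow> v \<in> p"
    and Spec_meet_iff: "\<lbrakk>u \<in> carrier L; v \<in> carrier L\<rbrakk> \<Longrightarrow> u \<sqinter> v \<in> p \<longleftrightarrow> u \<in> p \<and> v \<in> p"
    and Spec_join_iff: "\<lbrakk>u \<in> carrier L; v \<in> carrier L\<rbrakk> \<Longrightarrow> u \<squnion> v \<in> p \<longleftrightarrow> u \<in> p \<or> v \<in> p"
proof -
  interpret bounded_distrib_lattice L by fact
  have sub: "p \<subseteq> carrier L" "p \<noteq> {}" "p \<noteq> carrier L"
    and up: "\<And>u v. \<lbrakk>u \<in> p; u \<sqsubseteq> v; v \<in> carrier L\<rbrakk> \<Longrightarrow> v \<in> p"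
    and meet: "\<And>u v. \<lbrakk>u \<in> p; v \<in> p\<rbrakk> \<Longrightarrow> u \<sqinter> v \<in> p"
    and join: "\<And>u v. \<lbrakk>u \<squnion> v \<in> p; u \<in> carrier L; v \<in> carrier L\<rbrakk> \<Longrightarrow> u \<in> p \<or> v \<in> p"
    using p by (simp_all add: Spec_def prime_filter_def lattice_filter_def)
  obtain x where "x \<in> p"
    using sub(2) by blast
  then show "\<top> \<in> p"
    using up sub(1) top_higher top_closed by blast
  show "\<bottom> \<notin> p"
    using up sub(1,3) bottom_lower by blast
  show "\<lbrakk>u \<in> p; u \<sqsubseteq> v; v \<in> carrier L\<rbrakk> \<Longrightarrow> v \<in> p"
    by (rule up)
  show "\<lbrakk>u \<in> carrier L; v \<in> carrier L\<rbrakk> \<Longrightarrow> u \<sqinter> v \<in> p \<longleftrightarrow> u \<in> p \<and> v \<in> p"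
    using up meet meet_left meet_right by blast
  show "\<lbrakk>u \<in> carrier L; v \<in> carrier L\<rbrakk> \<Longrightarrow> u \<squnion> v \<in> p \<longleftrightarrow> u \<in> p \<or> v \<in> p"
    using up join join_left join_right join_closed by meson
qed

text \<open>Meets are preserved because the points are filters, joins because they are prime, and
  the bottom element because they are proper.\<close>

lemma bounded_lattice_hom_Spec:
  assumes "bounded_distrib_lattice L"
  shows "bounded_lattice_hom L (powerset_lattice (Spec L)) (\<lambda>u. {p \<in> Spec L. u \<in> p})"
proof -
  interpret bounded_distrib_lattice L by fact
  show ?thesis
    using bounded_lattice.axioms(1)[OF powerset_lattice_bounded] lattice_axioms assms
    by (auto simp: bounded_lattice_hom_def meet_pres_def join_pres_def powerset_lattice_ops
        Spec_top Spec_bottom Spec_meet_iff Spec_join_iff carrier_powerset_lattice)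
qed

section \<open>Valued groups\<close>

lemma fun_group_simps:
  shows "carrier (fun_group X \<Gamma>) = X \<rightarrow>\<^sub>E carrier \<Gamma>"
    and "f \<otimes>\<^bsub>fun_group X \<Gamma>\<^esub> g = (\<lambda>x\<in>X. f x \<otimes>\<^bsub>\<Gamma>\<^esub> g x)"
    and "gle (fun_group X \<Gamma>) f g \<longleftrightarrow> (\<forall>x\<in>X. gle \<Gamma> (f x) (g x))"
  by (simp_all add: fun_group_def)

context
  fixes X :: "'x set" and \<Gamma> :: "'h ogroup"
  assumes \<Gamma>: "l_group \<Gamma>"
begin

interpretation \<Gamma>: l_group \<Gamma> by (rule \<Gamma>)

lemma lattice_fun_group: "lattice (order_of (fun_group X \<Gamma>))"
proof -
  let ?F = "order_of (fun_group X \<Gamma>)"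
  have mem: "f x \<in> carrier \<Gamma>" if "f \<in> X \<rightarrow>\<^sub>E carrier \<Gamma>" "x \<in> X" for f x
    using that by auto
  have antisym: "f = g" if "f \<in> X \<rightarrow>\<^sub>E carrier \<Gamma>" "g \<in> X \<rightarrow>\<^sub>E carrier \<Gamma>"
    "\<forall>x\<in>X. gle \<Gamma> (f x) (g x)" "\<forall>x\<in>X. gle \<Gamma> (g x) (f x)" for f g
    using that by (intro PiE_ext) (auto intro!: \<Gamma>.L.le_antisym)
  have trans: "gle \<Gamma> (f x) (h x)" if "f \<in> X \<rightarrow>\<^sub>E carrier \<Gamma>" "g \<in> X \<rightarrow>\<^sub>E carrier \<Gamma>" "h \<in> X \<rightarrow>\<^sub>E carrier \<Gamma>"
    "\<forall>x\<in>X. gle \<Gamma> (f x) (g x)" "\<forall>x\<in>X. gle \<Gamma> (g x) (h x)" "x \<in> X" for f g h x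
    using that mem \<Gamma>.L.le_trans by meson
  have sup: "\<exists>s. least ?F s (Upper ?F {f, g})"
    if "f \<in> X \<rightarrow>\<^sub>E carrier \<Gamma>" "g \<in> X \<rightarrow>\<^sub>E carrier \<Gamma>" for f g
    using that mem
    by (intro exI[of _ "\<lambda>x\<in>X. f x \<squnion>\<^bsub>order_of \<Gamma>\<^esub> g x"])
      (auto simp: least_def Upper_def fun_group_simps
        intro!: \<Gamma>.L.join_left \<Gamma>.L.join_right \<Gamma>.L.join_le)
  have inf: "\<exists>s. greatest ?F s (Lower ?F {f, g})"
    if "f \<in> X \<rightarrow>\<^sub>E carrier \<Gamma>" "g \<in> X \<rightarrow>\<^sub>E carrier \<Gamma>" for f g
    using that mem
    by (intro exI[of _ "\<lambda>x\<in>X. f x \<sqinter>\<^bsub>order_of \<Gamma>\<^esub> g x"])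
      (auto simp: greatest_def Lower_def fun_group_simps
        intro!: \<Gamma>.L.meet_left \<Gamma>.L.meet_right \<Gamma>.L.meet_le)
  show ?thesis
    by unfold_locales
      (use mem sup inf in \<open>auto simp: fun_group_simps intro: antisym trans\<close>)
qed

lemma fun_group_ops:
  assumes "f \<in> X \<rightarrow>\<^sub>E carrier \<Gamma>" "g \<in> X \<rightarrow>\<^sub>E carrier \<Gamma>"
  shows "f \<sqinter>\<^bsub>order_of (fun_group X \<Gamma>)\<^esub> g = (\<lambda>x\<in>X. f x \<sqinter>\<^bsub>order_of \<Gamma>\<^esub> g x)"
    and "f \<squnion>\<^bsub>order_of (fun_group X \<Gamma>)\<^esub> g = (\<lambda>x\<in>X. f x \<squnion>\<^bsub>order_of \<Gamma>\<^esub> g x)"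
proof -
  interpret F: lattice "order_of (fun_group X \<Gamma>)"
    by (rule lattice_fun_group)
  have mem: "f x \<in> carrier \<Gamma>" if "f \<in> X \<rightarrow>\<^sub>E carrier \<Gamma>" "x \<in> X" for f x
    using that by auto
  show "f \<sqinter>\<^bsub>order_of (fun_group X \<Gamma>)\<^esub> g = (\<lambda>x\<in>X. f x \<sqinter>\<^bsub>order_of \<Gamma>\<^esub> g x)"
    using assms mem
    by (intro F.meet_eqI)
      (auto simp: fun_group_simps intro!: \<Gamma>.L.meet_left \<Gamma>.L.meet_right \<Gamma>.L.meet_le)
  show "f \<squnion>\<^bsub>order_of (fun_group X \<Gamma>)\<^esub> g = (\<lambda>x\<in>X. f x \<squnion>\<^bsub>order_of \<Gamma>\<^esub> g x)"
    using assms mem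
    by (intro F.join_eqI)
      (auto simp: fun_group_simps intro!: \<Gamma>.L.join_left \<Gamma>.L.join_right \<Gamma>.L.join_le)
qed

end

section \<open>Homomorphisms attached to prime filters\<close>

locale valued_group = G: l_group G + L: bounded_distrib_lattice L
  for G :: "'g ogroup" (structure) and L :: "'l gorder" +
  fixes P :: "'g \<Rightarrow> 'l"
  assumes P_closed: "a \<in> carrier G \<Longrightarrow> P a \<in> carrier L"
    and P_meet: "\<lbrakk>a \<in> carrier G; b \<in> carrier G\<rbrakk> \<Longrightarrow> P (a \<sqinter>\<^bsub>order_of G\<^esub> b) = P a \<sqinter>\<^bsub>L\<^esub> P b"
    and P_join: "\<lbrakk>a \<in> carrier G; b \<in> carrier G\<rbrakk> \<Longrightarrow> P (a \<squnion>\<^bsub>order_of G\<^esub> b) = P a \<squnion>\<^bsub>L\<^esub> P b"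
    and P_one: "P \<one> = \<top>\<^bsub>L\<^esub>"
    and P_mult: "\<lbrakk>a \<in> carrier G; b \<in> carrier G\<rbrakk> \<Longrightarrow> P a \<sqinter>\<^bsub>L\<^esub> P b \<sqsubseteq>\<^bsub>L\<^esub> P (a \<otimes> b)"
begin

text \<open>Preservation of the join of \<open>\<one>\<close> and a gives it. Density is precisely
  the converse.\<close>

lemma P_of_one_le:
  assumes "a \<in> carrier G" "\<one> \<preceq> a"
  shows "P a = \<top>\<^bsub>L\<^esub>"
proof -
  have "\<one> \<squnion>\<^bsub>order_of G\<^esub> a = a"
    using assms by (intro G.L.join_eqI) auto
  then have "P a = \<top>\<^bsub>L\<^esub> \<squnion>\<^bsub>L\<^esub> P a"
    using assms P_join[of \<one> a] by (simp add: P_one)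
  then show ?thesis
    using assms L.top_join[of "P a"] P_closed by (simp add: L.eq_is_equal)
qed

context
  fixes p
  assumes p: "p \<in> Spec L"
begin

lemmas prime = Spec_top [OF L.bounded_distrib_lattice_axioms p]
  Spec_up [OF L.bounded_distrib_lattice_axioms p]
  Spec_meet_iff [OF L.bounded_distrib_lattice_axioms p]
  Spec_join_iff [OF L.bounded_distrib_lattice_axioms p]

lemma total_cone_prime: "total_cone G {a \<in> carrier G. P a \<in> p}"
proof unfold_locales
  show "x \<otimes> y \<in> {a \<in> carrier G. P a \<in> p}"
    if "x \<in> {a \<in> carrier G. P a \<in> p}" "y \<in> {a \<in> carrier G. P a \<in> p}" for x y
    using that prime(2)[OF _ P_mult] by (simp add: P_closed prime(3))
  show "x \<in> {a \<in> carrier G. P a \<in> p} \<or> inv x \<in> {a \<in> carrier G. P a \<in> p}"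
    if x: "x \<in> carrier G" for x
  proof -
    have "P x \<squnion>\<^bsub>L\<^esub> P (inv x) = \<top>\<^bsub>L\<^esub>"
      using x P_of_one_le[OF _ G.one_le_join_inv[OF x]] by (simp add: P_join)
    then have "P x \<in> p \<or> P (inv x) \<in> p"
      using x prime(1) prime(4)[of "P x" "P (inv x)"] P_closed by simp
    then show ?thesis
      using x by simp
  qed
qed auto

context
  fixes \<Gamma> :: "'h ogroup" and \<phi>
  assumes \<Gamma>: "o_group \<Gamma>" and hom: "\<phi> \<in> hom G \<Gamma>"
    and sign: "\<And>a. a \<in> carrier G \<Longrightarrow> gle \<Gamma> \<one>\<^bsub>\<Gamma>\<^esub> (\<phi> a) \<longleftrightarrow> P a \<in> p"
begin

interpretation \<Gamma>: o_group \<Gamma> by (rule \<Gamma>)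
interpretation \<phi>: group_hom G \<Gamma> \<phi>
  by (simp add: group_hom_def group_hom_axioms_def hom)

lemma hom_le_iff:
  assumes "a \<in> carrier G" "b \<in> carrier G"
  shows "gle \<Gamma> (\<phi> a) (\<phi> b) \<longleftrightarrow> P (b \<otimes> inv a) \<in> p"
  using assms sign[of "b \<otimes> inv a"] \<Gamma>.one_le_div_iff[of "\<phi> a" "\<phi> b"] by simp

lemma hom_mono:
  assumes "a \<in> carrier G" "b \<in> carrier G" "a \<preceq> b"
  shows "gle \<Gamma> (\<phi> a) (\<phi> b)"
  using assms P_of_one_le[of "b \<otimes> inv a"] by (simp add: hom_le_iff prime(1) G.one_le_div_iff)

text \<open>The hypothesis compares only the images; a and b may be incomparable in G. What must be
  shown is that the meet agrees with a, and the join with b, up to elements null at p.\<close>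

lemma hom_meet_join_of_le:
  assumes a: "a \<in> carrier G" and b: "b \<in> carrier G" and le: "gle \<Gamma> (\<phi> a) (\<phi> b)"
  shows "\<phi> (a \<sqinter>\<^bsub>order_of G\<^esub> b) = \<phi> a" "\<phi> (a \<squnion>\<^bsub>order_of G\<^esub> b) = \<phi> b"
proof -
  define m where "m = a \<sqinter>\<^bsub>order_of G\<^esub> b"
  define j where "j = a \<squnion>\<^bsub>order_of G\<^esub> b"
  have m: "m \<in> carrier G" "m \<preceq> a" and j: "j \<in> carrier G" "b \<preceq> j"
    using a b G.L.meet_left G.L.join_right by (auto simp: m_def j_def)
  \<comment> \<open>Translated by the inverse of a, the meet has value top \<sqinter> P (b - a),
    additively written, which lies in p by the hypothesis on the images.\<close>
  have "m \<otimes> inv a = \<one> \<sqinter>\<^bsub>order_of G\<^esub> (b \<otimes> inv a)"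
    using a b by (simp add: m_def G.meet_mult)
  then have "P (m \<otimes> inv a) = \<top>\<^bsub>L\<^esub> \<sqinter>\<^bsub>L\<^esub> P (b \<otimes> inv a)"
    using a b by (simp add: P_meet P_one)
  then have "gle \<Gamma> (\<phi> a) (\<phi> m)"
    using a b m le by (simp add: hom_le_iff prime P_closed)
  then show "\<phi> (a \<sqinter>\<^bsub>order_of G\<^esub> b) = \<phi> a"
    using a m hom_mono[of m a] \<Gamma>.L.le_antisym by (simp add: m_def)
  \<comment> \<open>Applying P gives a join equal to top; primeness of p then bounds the image of j
    by that of a or of b, and in either case by that of b.\<close>
  have "(a \<otimes> inv j) \<squnion>\<^bsub>order_of G\<^esub> (b \<otimes> inv j) = \<one>"
    using a b j G.join_mult[of a b "inv j"] by (simp add: j_def)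
  then have "P (a \<otimes> inv j) \<squnion>\<^bsub>L\<^esub> P (b \<otimes> inv j) = \<top>\<^bsub>L\<^esub>"
    using a b j P_join[of "a \<otimes> inv j" "b \<otimes> inv j"] by (simp add: P_one)
  then have "gle \<Gamma> (\<phi> j) (\<phi> a) \<or> gle \<Gamma> (\<phi> j) (\<phi> b)"
    using a b j prime(1) prime(4)[of "P (a \<otimes> inv j)" "P (b \<otimes> inv j)"] P_closed
    by (simp add: hom_le_iff)
  then have "gle \<Gamma> (\<phi> j) (\<phi> b)"
    using a b j le \<Gamma>.L.le_trans \<phi>.hom_closed by blast
  then show "\<phi> (a \<squnion>\<^bsub>order_of G\<^esub> b) = \<phi> b"
    using b j hom_mono[of b j] \<Gamma>.L.le_antisym by (simp add: j_def)
qed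

lemma hom_meet_join:
  assumes a: "a \<in> carrier G" and b: "b \<in> carrier G"
  shows "\<phi> (a \<sqinter>\<^bsub>order_of G\<^esub> b) = \<phi> a \<sqinter>\<^bsub>order_of \<Gamma>\<^esub> \<phi> b"
    and "\<phi> (a \<squnion>\<^bsub>order_of G\<^esub> b) = \<phi> a \<squnion>\<^bsub>order_of \<Gamma>\<^esub> \<phi> b"
proof -
  have *: "\<phi> (a \<sqinter>\<^bsub>order_of G\<^esub> b) = \<phi> a \<sqinter>\<^bsub>order_of \<Gamma>\<^esub> \<phi> b \<and>
      \<phi> (a \<squnion>\<^bsub>order_of G\<^esub> b) = \<phi> a \<squnion>\<^bsub>order_of \<Gamma>\<^esub> \<phi> b"
    if "a \<in> carrier G" "b \<in> carrier G" "gle \<Gamma> (\<phi> a) (\<phi> b)" for a b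
  proof -
    have "\<phi> a \<sqinter>\<^bsub>order_of \<Gamma>\<^esub> \<phi> b = \<phi> a" "\<phi> a \<squnion>\<^bsub>order_of \<Gamma>\<^esub> \<phi> b = \<phi> b"
      using that by (auto intro!: \<Gamma>.L.meet_eqI \<Gamma>.L.join_eqI)
    then show ?thesis
      using that by (simp add: hom_meet_join_of_le)
  qed
  have "gle \<Gamma> (\<phi> a) (\<phi> b) \<or> gle \<Gamma> (\<phi> b) (\<phi> a)"
    using total_order.total_order_total[OF \<Gamma>.total_order, of "\<phi> a" "\<phi> b"] a b by simp
  then show "\<phi> (a \<sqinter>\<^bsub>order_of G\<^esub> b) = \<phi> a \<sqinter>\<^bsub>order_of \<Gamma>\<^esub> \<phi> b"
    and "\<phi> (a \<squnion>\<^bsub>order_of G\<^esub> b) = \<phi> a \<squnion>\<^bsub>order_of \<Gamma>\<^esub> \<phi> b"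
    using *[OF a b] *[OF b a] by (auto simp: meet_comm join_comm)
qed

end

end

lemma valued_embedding_Stan:
  fixes \<Gamma> :: "'h ogroup"
  assumes \<Gamma>: "o_group \<Gamma>"
    and hom: "\<And>p. p \<in> Spec L \<Longrightarrow> \<phi> p \<in> hom G \<Gamma>"
    and sign: "\<And>p a. \<lbrakk>p \<in> Spec L; a \<in> carrier G\<rbrakk> \<Longrightarrow> gle \<Gamma> \<one>\<^bsub>\<Gamma>\<^esub> (\<phi> p a) \<longleftrightarrow> P a \<in> p"
    and dense: "\<And>a. \<lbrakk>a \<in> carrier G; P a = \<top>\<^bsub>L\<^esub>\<rbrakk> \<Longrightarrow> \<one> \<preceq> a"
  shows "valued_embedding \<lparr>vgroup = G, vlattice = L, val = P\<rparr> (Stan (Spec L) \<Gamma>)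
    (\<lambda>a. \<lambda>p\<in>Spec L. \<phi> p a) (\<lambda>u. {p \<in> Spec L. u \<in> p})"
proof -
  interpret \<Gamma>: o_group \<Gamma> by (rule \<Gamma>)
  define I where "I = (\<lambda>a. \<lambda>p\<in>Spec L. \<phi> p a)"
  define J where "J = (\<lambda>u. {p \<in> Spec L. u \<in> p})"
  have closed: "\<phi> p a \<in> carrier \<Gamma>" if "p \<in> Spec L" "a \<in> carrier G" for p a
    using hom that by (auto simp: hom_def)
  then have I_closed: "I a \<in> Spec L \<rightarrow>\<^sub>E carrier \<Gamma>" if "a \<in> carrier G" for a
    using that by (auto simp: I_def)
  have "I \<in> hom G (fun_group (Spec L) \<Gamma>)"
    using I_closed hom by (intro homI) (auto simp: fun_group_simps I_def hom_mult intro!: restrict_ext)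
  moreover have "meet_pres (order_of G) (order_of (fun_group (Spec L) \<Gamma>)) I"
    "join_pres (order_of G) (order_of (fun_group (Spec L) \<Gamma>)) I"
    using G.lattice_order lattice_fun_group[OF \<Gamma>.l_group_axioms] I_closed
    by (auto simp: meet_pres_def join_pres_def fun_group_ops[OF \<Gamma>.l_group_axioms] I_def
        hom_meet_join[OF _ \<Gamma> hom sign] intro!: restrict_ext)
  ultimately have "l_group_hom G (fun_group (Spec L) \<Gamma>) I"
    by (simp add: l_group_hom_def)
  moreover have "bounded_lattice_hom L (powerset_lattice (Spec L)) J"
    unfolding J_def by (rule bounded_lattice_hom_Spec) (rule L.bounded_distrib_lattice_axioms)
  \<comment> \<open>One inequality suffices, as the assumption is symmetric in a and b. Equal images
    put P (b - a) in every prime filter, so it cannot be separated from top and must be top.\<close>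
  moreover have le: "a \<preceq> b" if ab: "a \<in> carrier G" "b \<in> carrier G" and eq: "I a = I b" for a b
  proof -
    have "P (b \<otimes> inv a) \<in> p" if p: "p \<in> Spec L" for p
    proof -
      have "\<phi> p a = \<phi> p b"
        using fun_cong[OF eq, of p] p by (simp add: I_def)
      then have "gle \<Gamma> (\<phi> p a) (\<phi> p b)"
        using closed[OF p ab(2)] by simp
      then show ?thesis
        using hom_le_iff[OF p \<Gamma> hom sign] p ab by blast
    qed
    then have "\<top>\<^bsub>L\<^esub> \<sqsubseteq>\<^bsub>L\<^esub> P (b \<otimes> inv a)"
      using exists_prime_filter[OF L.bounded_distrib_lattice_axioms, of "\<top>\<^bsub>L\<^esub>" "P (b \<otimes> inv a)"] ab P_closed by auto
    then have "P (b \<otimes> inv a) = \<top>\<^bsub>L\<^esub>"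
      using ab P_closed by (intro L.le_antisym) auto
    then show "a \<preceq> b"
      using dense[of "b \<otimes> inv a"] ab by (simp add: G.one_le_div_iff)
  qed
  then have "inj_on I (carrier G)"
    by (intro inj_onI) (metis G.L.le_antisym)
  moreover have "inj_on J (carrier L)"
  proof (rule inj_onI)
    fix u v assume *: "u \<in> carrier L" "v \<in> carrier L" "J u = J v"
    then have "u \<in> p \<longleftrightarrow> v \<in> p" if "p \<in> Spec L" for p
      using that by (auto simp: J_def)
    then show "u = v"
      using * exists_prime_filter[OF L.bounded_distrib_lattice_axioms, of u v] exists_prime_filter[OF L.bounded_distrib_lattice_axioms, of v u] L.le_antisym by blast
  qed
  \<comment> \<open>Compatibility with the valuations is the sign condition collected over all
    p.\<close>
  moreover have "{p \<in> Spec L. gle \<Gamma> \<one>\<^bsub>\<Gamma>\<^esub> (I a p)} = J (P a)" if "a \<in> carrier G" for a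
    using that sign by (auto simp: I_def J_def)
  ultimately show ?thesis
    by (simp add: valued_embedding_def Stan_def flip: I_def J_def)
qed

end

theorem mainTheorem3:
  fixes V :: "('g, 'l) valued"
  assumes "densely_valued V"
  shows "\<exists>\<Gamma> :: ('g, 'l) fractions ogroup.
           divisible_o_group \<Gamma> \<and> embeds V (Stan (Spec (vlattice V)) \<Gamma>)"
proof -
  obtain G :: "'g ogroup" and L :: "'l gorder" and P where V: "V = \<lparr>vgroup = G, vlattice = L, val = P\<rparr>"
    by (cases V)
  then interpret valued_group G L P
    using assms
    by (auto simp: densely_valued_def valued_l_group_def Let_def Pi_iff
        intro!: valued_group.intro valued_group_axioms.intro)
  have dense: "gle G \<one>\<^bsub>G\<^esub> a" if "a \<in> carrier G" "P a = \<top>\<^bsub>L\<^esub>" for a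
    using assms that by (simp add: V densely_valued_def)
  \<comment> \<open>The cones are indexed by the prime filters themselves, so the index type is
    \<open>'l set\<close> and \<Gamma> has elements of type \<open>fractions\<close>.\<close>
  obtain \<Gamma> :: "('g, 'l) fractions ogroup" and \<phi> where \<Gamma>: "divisible_o_group \<Gamma>"
    and \<phi>: "\<And>p. p \<in> Spec L \<Longrightarrow> \<phi> p \<in> hom G \<Gamma>"
      "\<And>p a. \<lbrakk>p \<in> Spec L; a \<in> carrier G\<rbrakk> \<Longrightarrow> gle \<Gamma> \<one>\<^bsub>\<Gamma>\<^esub> (\<phi> p a) \<longleftrightarrow> P a \<in> p"
    using exists_divisible_o_group_separating_cones[OF G.comm_group_axioms total_cone_prime,
        of "Spec L" "\<lambda>p. p"] by auto
  have "embeds V (Stan (Spec (vlattice V)) \<Gamma>)"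
    using valued_embedding_Stan[OF divisible_o_group.axioms(1)[OF \<Gamma>] \<phi> dense]
    unfolding V embeds_def valued.simps by (intro exI)
  with \<Gamma> show ?thesis
    by blast
qed

end
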